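(* Let $\Gamma$ be a finite tree that has a perfect matching. Then $\Gamma$ is $1$-lit.
   Context: Let $\Gamma=(S,R)$ be a finite simple graph. A configuration of the lit-only $\sigma$-game on $\Gamma$ is an assignment of one of two states, on or off, to every vertex of $\Gamma$. Given a configuration, a move consists of choosing a vertex $s$ whose state is on and changing the states of all neighbors of $s$ (on becomes off and off becomes on). For an integer $k$, $\Gamma$ is called $k$-lit if, for every configuration, the number of on vertices can be reduced to at most $k$ by a finite sequence of moves. *)

theory Defs
  imports "Graph_Theory.Graph_Theory"
begin

text \<open>
  A finite simple graph is a \<^locale>\<open>pair_graph\<close>: a finite vertex set with a symmetric irreflexive
  arc relation, the undirected edge \<open>{u, v}\<close> being represented by both \<open>(u, v)\<close> and \<open>(v, u)\<close>.
\<close>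

definition neighbors :: "'a pair_pre_digraph \<Rightarrow> 'a \<Rightarrow> 'a set" where
  "neighbors G s = {t. (s, t) \<in> parcs G}"

definition undirected_edges :: "'a pair_pre_digraph \<Rightarrow> 'a set set" where
  "undirected_edges G = {{u, v} |u v. (u, v) \<in> parcs G}"

text \<open>
  The library predicates \<^const>\<open>forest\<close> and \<^const>\<open>tree\<close> are meant for directed graphs: in a symmetric
  digraph every edge yields the directed cycle \<open>u, v, u\<close>. A cycle of an undirected simple graph
  is a directed cycle with at least three arcs.
\<close>

definition undirected_forest :: "'a pair_pre_digraph \<Rightarrow> bool" where
  "undirected_forest G \<longleftrightarrow> \<not> (\<exists>p. pre_digraph.cycle (with_proj G) p \<and> 3 \<le> length p)"

definition undirected_tree :: "'a pair_pre_digraph \<Rightarrow> bool" where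
  "undirected_tree G \<longleftrightarrow> connected (with_proj G) \<and> undirected_forest G"

definition perfect_matching :: "'a pair_pre_digraph \<Rightarrow> 'a set set \<Rightarrow> bool" where
  "perfect_matching G M \<longleftrightarrow>
     M \<subseteq> undirected_edges G \<and> (\<forall>v \<in> pverts G. \<exists>!e. e \<in> M \<and> v \<in> e)"

text \<open>
  A configuration is given by its set \<open>X \<subseteq> pverts G\<close> of on vertices, so toggling the
  neighbors of \<open>s\<close> is taking the symmetric difference with \<^term>\<open>neighbors G s\<close>.
\<close>

inductive lit_only_move :: "'a pair_pre_digraph \<Rightarrow> 'a set \<Rightarrow> 'a set \<Rightarrow> bool"
  for G :: "'a pair_pre_digraph" where
  "s \<in> X \<Longrightarrow> lit_only_move G X (sym_diff X (neighbors G s))"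

definition lit :: "int \<Rightarrow> 'a pair_pre_digraph \<Rightarrow> bool" where
  "lit k G \<longleftrightarrow>
     (\<forall>X \<subseteq> pverts G. \<exists>Y. (lit_only_move G)\<^sup>*\<^sup>* X Y \<and> int (card Y) \<le> k)"

end

theory Submission
  imports Defs
begin

text \<open>
  The adjacency matrix of a tree with a perfect matching is invertible over the field with two
  elements, so each configuration is \<open>{t. odd_nb X t}\<close> for a unique vertex set \<open>X\<close>. A lit-only move
  at \<open>s\<close> becomes the transvection toggling \<open>s\<close> in \<open>X\<close>, which is allowed when \<open>X\<close> contains an odd
  number of neighbors of \<open>s\<close> and which preserves the quadratic form \<open>quad\<close>. If some vertex has
  three neighbors, the tree arises from one matched edge by attaching pendant paths of length two,
  passing through the Dynkin diagram \<open>E\<^sub>6\<close>. Along this construction the nonempty vertex sets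
  with a given value of \<open>quad\<close> stay a single orbit, and both values are attained by sets dual to a
  single vertex. In the remaining case the tree is a path, where moves are adjacent transpositions
  and the game is sorting.
\<close>

section \<open>The dual game and its quadratic form\<close>

context pair_graph
begin

abbreviation nb :: "'a \<Rightarrow> 'a set" where
  "nb \<equiv> neighbors G"

lemma in_nb_iff: "t \<in> nb s \<longleftrightarrow> (s, t) \<in> parcs G"
  by (simp add: neighbors_def)

lemma nb_sym: "t \<in> nb s \<longleftrightarrow> s \<in> nb t"
  using pair_sym_arcs by (auto simp: in_nb_iff symmetric_def dest: symD)

lemma nb_irrefl: "s \<notin> nb s"
  using pair_no_loops by (fastforce simp: in_nb_iff)

lemma nb_subset_verts: "nb s \<subseteq> pverts G"
  by (auto simp: in_nb_iff dest: in_arcsD2)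

lemma finite_nb: "finite (nb s)"
  using nb_subset_verts pair_finite_verts by (rule finite_subset)

text \<open>The coordinate at \<open>s\<close> of the adjacency matrix applied to \<open>X\<close>,
  i.e. the adjacency form of \<open>X\<close> and \<open>{s}\<close> over the field with two
  elements.\<close>

definition odd_nb :: "'a set \<Rightarrow> 'a \<Rightarrow> bool" where
  "odd_nb X s \<longleftrightarrow> odd (card (nb s \<inter> X))"

text \<open>The quadratic form over the field with two elements that takes the value 1 on each vertex and
  polarizes to the adjacency form.\<close>

definition quad :: "'a set \<Rightarrow> bool" where
  "quad X \<longleftrightarrow> odd (card X + card {e \<in> undirected_edges G. e \<subseteq> X})"

text \<open>Only vertices of \<open>W\<close> may be toggled, so that orbits can be followed on the
  partial trees of the construction.\<close>

inductive dual_move :: "'a set \<Rightarrow> 'a set \<Rightarrow> 'a set \<Rightarrow> bool" for W where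
  "s \<in> W \<Longrightarrow> odd_nb X s \<Longrightarrow> dual_move W X (sym_diff X {s})"

abbreviation reaches :: "'a set \<Rightarrow> 'a set \<Rightarrow> 'a set \<Rightarrow> bool" where
  "reaches W \<equiv> (dual_move W)\<^sup>*\<^sup>*"

lemma odd_nb_empty [simp]: "\<not> odd_nb {} s"
  by (simp add: odd_nb_def)

lemma odd_nb_insert: "t \<notin> X \<Longrightarrow> odd_nb (insert t X) s \<longleftrightarrow> odd_nb X s \<noteq> (t \<in> nb s)"
  by (cases "t \<in> nb s") (auto simp: odd_nb_def finite_nb)

lemma odd_nb_toggle: "odd_nb (sym_diff X {t}) s \<longleftrightarrow> odd_nb X s \<noteq> (t \<in> nb s)"
proof (cases "t \<in> X")
  case True
  then have "X = insert t (X - {t})" "sym_diff X {t} = X - {t}" by auto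
  then show ?thesis using odd_nb_insert[of t "X - {t}" s] by auto
next
  case False
  then show ?thesis using odd_nb_insert[of t X s] by simp
qed

lemma quad_empty [simp]: "\<not> quad {}"
proof -
  have "{e \<in> undirected_edges G. e \<subseteq> {}} = {}"
    by (auto simp: undirected_edges_def)
  then show ?thesis by (simp only: quad_def card.empty) simp
qed

text \<open>The edges gained by adding \<open>s\<close> are exactly the \<open>{s, t}\<close> with
  \<open>t\<close> in \<open>nb s \<inter> X\<close>, so the count in \<open>quad\<close> grows by
  \<open>1 + card (nb s \<inter> X)\<close>.\<close>

lemma quad_insert:
  assumes "finite X" "s \<notin> X"
  shows "quad (insert s X) \<longleftrightarrow> quad X = odd_nb X s"
proof -
  let ?E = "\<lambda>X. {e \<in> undirected_edges G. e \<subseteq> X}"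
  let ?F = "(\<lambda>t. {s, t}) ` (nb s \<inter> X)"
  have E: "?E (insert s X) = ?E X \<union> ?F"
  proof (intro equalityI subsetI)
    fix e assume e: "e \<in> ?E (insert s X)"
    then obtain u v where uv: "e = {u, v}" "v \<in> nb u"
      by (auto simp: undirected_edges_def in_nb_iff)
    with e assms nb_irrefl nb_sym[of u v] show "e \<in> ?E X \<union> ?F"
      by (cases "u = s"; cases "v = s") auto
  next
    fix e assume "e \<in> ?E X \<union> ?F"
    then show "e \<in> ?E (insert s X)"
      unfolding undirected_edges_def in_nb_iff[symmetric] by blast
  qed
  have fin: "finite (?E X)"
    using assms by (auto intro: finite_subset[of _ "Pow X"])
  have "inj_on (\<lambda>t. {s, t}) (nb s \<inter> X)"
    by (auto simp: inj_on_def doubleton_eq_iff)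
  then have "card ?F = card (nb s \<inter> X)" by (rule card_image)
  moreover have "card (?E X \<union> ?F) = card (?E X) + card ?F"
    using assms fin by (intro card_Un_disjoint) auto
  ultimately show ?thesis
    using assms unfolding quad_def odd_nb_def E by auto
qed

lemma quad_singleton: "quad {s}"
  using quad_insert[of "{}" s] by simp

lemma quad_edge: "a \<in> nb v \<Longrightarrow> quad {a, v}"
proof -
  assume a: "a \<in> nb v"
  then have "a \<noteq> v" using nb_irrefl by auto
  then have "quad {a, v} \<longleftrightarrow> odd_nb {v} a"
    using quad_insert[of "{v}" a] quad_singleton by simp
  also have "\<dots> \<longleftrightarrow> v \<in> nb a" using odd_nb_insert[of v "{}" a] by simp
  finally show ?thesis using a nb_sym[of a v] by simp
qed

text \<open>In particular \<open>quad\<close> is invariant under dual moves, which require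
  \<open>odd_nb X s\<close>.\<close>

lemma quad_toggle:
  assumes "finite X"
  shows "quad (sym_diff X {s}) \<longleftrightarrow> quad X = odd_nb X s"
proof (cases "s \<in> X")
  case True
  then have "X = insert s (X - {s})" "sym_diff X {s} = X - {s}" by auto
  then show ?thesis
    using quad_insert[of "X - {s}" s] odd_nb_insert[of s "X - {s}" s] nb_irrefl assms by auto
next
  case False
  then show ?thesis using quad_insert[of X s] assms by simp
qed

text \<open>Transvections are involutions: \<open>s\<close> is not its own neighbor, so toggling it
  leaves the condition at \<open>s\<close> intact.\<close>

lemma dual_move_sym: "dual_move W X Y \<Longrightarrow> dual_move W Y X"
proof (induction rule: dual_move.induct)
  case (1 s X)
  have "sym_diff (sym_diff X {s}) {s} = X" by auto
  moreover have "odd_nb (sym_diff X {s}) s"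
    using 1 by (simp add: odd_nb_toggle nb_irrefl)
  ultimately show ?case using dual_move.intros[of s W "sym_diff X {s}"] 1 by simp
qed

lemma reaches_sym: "reaches W X Y \<Longrightarrow> reaches W Y X"
  by (induction rule: rtranclp_induct)
    (auto intro: converse_rtranclp_into_rtranclp dual_move_sym)

lemma reaches_toggle: "s \<in> W \<Longrightarrow> odd_nb X s \<Longrightarrow> reaches W X (sym_diff X {s})"
  by (intro r_into_rtranclp dual_move.intros)

lemma reaches_subset: "reaches W X Y \<Longrightarrow> X \<subseteq> W \<Longrightarrow> Y \<subseteq> W"
  by (induction rule: rtranclp_induct) (auto elim!: dual_move.cases)

lemma quad_reaches: "reaches W X Y \<Longrightarrow> finite X \<Longrightarrow> finite Y \<and> quad Y = quad X"
proof (induction rule: rtranclp_induct)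
  case (step Y Z)
  from step.hyps(2) show ?case
    using step.IH step.prems by cases (auto simp: quad_toggle)
qed simp

text \<open>Orbits are as large as the invariant \<open>quad\<close> permits. The empty set is set
  apart because no move applies to it.\<close>

definition transitive :: "'a set \<Rightarrow> bool" where
  "transitive W \<longleftrightarrow>
     (\<forall>X Y. X \<subseteq> W \<and> Y \<subseteq> W \<and> X \<noteq> {} \<and> Y \<noteq> {} \<and> quad X = quad Y \<longrightarrow> reaches W X Y)"

definition toggleable :: "'a set \<Rightarrow> 'a \<Rightarrow> bool" where
  "toggleable W p \<longleftrightarrow> (\<forall>e. \<exists>Z \<subseteq> W. Z \<noteq> {} \<and> \<not> quad Z \<and> \<not> odd_nb Z p \<and> (p \<in> Z \<longleftrightarrow> e))"

text \<open>Surjectivity, hence for finite \<open>W\<close> invertibility, of the adjacency matrix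
  of the subgraph induced on \<open>W\<close>.\<close>

definition solvable :: "'a set \<Rightarrow> bool" where
  "solvable W \<longleftrightarrow> (\<forall>F \<subseteq> W. \<exists>X \<subseteq> W. \<forall>s \<in> W. odd_nb X s \<longleftrightarrow> s \<in> F)"

end

section \<open>Attaching a pendant path of length two\<close>

text \<open>The path \<open>p\<close>, \<open>m\<close>, \<open>l\<close> hangs on \<open>W\<close>
  at \<open>p\<close>, with \<open>l\<close> as its end. Edges leaving
  \<open>insert l (insert m W)\<close> are left unconstrained.\<close>

locale pendant = pair_graph G for G :: "'a pair_pre_digraph" +
  fixes W :: "'a set" and p m l :: 'a
  assumes W_verts: "W \<subseteq> pverts G" and p_in: "p \<in> W" and m_notin: "m \<notin> W" and l_notin: "l \<notin> W"
    and nb_m: "nb m \<inter> W = {p}" and nb_l: "nb l \<inter> W = {}" and l_nb_m: "l \<in> nb m"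
begin

abbreviation W' :: "'a set" where
  "W' \<equiv> insert l (insert m W)"

lemma finite_W: "finite W"
  using W_verts pair_finite_verts by (rule finite_subset)

lemma m_neq_l: "m \<noteq> l"
  using l_nb_m nb_irrefl by auto

lemma odd_nb_l: "X \<subseteq> W' \<Longrightarrow> odd_nb X l \<longleftrightarrow> m \<in> X"
proof -
  assume "X \<subseteq> W'"
  then have "nb l \<inter> X = (if m \<in> X then {m} else {})"
    using nb_l l_nb_m nb_sym[of l m] nb_irrefl[of l] by auto
  then show ?thesis by (simp add: odd_nb_def)
qed

lemma odd_nb_m: "X \<subseteq> W' \<Longrightarrow> odd_nb X m \<longleftrightarrow> (l \<in> X) \<noteq> (p \<in> X)"
proof -
  assume "X \<subseteq> W'"
  then have "nb m \<inter> X = (if l \<in> X then {l} else {}) \<union> (if p \<in> X then {p} else {})"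
    using nb_m l_nb_m nb_irrefl[of m] by auto
  moreover have "l \<noteq> p" using p_in l_notin by auto
  ultimately show ?thesis by (simp add: odd_nb_def)
qed

text \<open>The only edge between \<open>W\<close> and the attached vertices joins \<open>p\<close>
  to \<open>m\<close>.\<close>

lemma odd_nb_W:
  assumes "X \<subseteq> W'" "s \<in> W"
  shows "odd_nb X s \<longleftrightarrow> odd_nb (X \<inter> W) s \<noteq> (s = p \<and> m \<in> X)"
proof -
  have l: "l \<notin> nb s" using nb_l assms nb_sym[of l s] by auto
  have m: "m \<in> nb s \<longleftrightarrow> s = p" using nb_m assms nb_sym[of m s] by auto
  have "nb s \<inter> X = nb s \<inter> (if m \<in> X then insert m (X \<inter> W) else X \<inter> W)"
    using assms l by auto
  then have "odd_nb X s = odd_nb (if m \<in> X then insert m (X \<inter> W) else X \<inter> W) s"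
    by (simp add: odd_nb_def)
  also have "\<dots> \<longleftrightarrow> odd_nb (X \<inter> W) s \<noteq> (s = p \<and> m \<in> X)"
    using m m_notin by (auto simp: odd_nb_insert)
  finally show ?thesis .
qed

text \<open>The hyperbolic plane spanned by \<open>l\<close> and \<open>m\<close> splits off orthogonally; \<open>X\<close> is excited
  when its component there is nonzero.\<close>

definition excited :: "'a set \<Rightarrow> bool" where
  "excited X \<longleftrightarrow> m \<in> X \<or> (l \<in> X) \<noteq> (p \<in> X)"

text \<open>The orthogonal complement of the plane is spanned by \<open>{p, l}\<close> and the other
  vertices of \<open>W\<close>. As \<open>quad {p, l}\<close> is false, the form there is that of
  \<open>W\<close> corrected by membership of \<open>p\<close>; on the plane every nonzero vector
  has value 1.\<close>

lemma quad_pendant: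
  assumes "X \<subseteq> W'"
  shows "quad X \<longleftrightarrow> (quad (X \<inter> W) \<noteq> (p \<in> X)) \<noteq> excited X"
proof -
  have fin: "finite X" using assms finite_W by (auto intro: finite_subset)
  let ?Y = "X - {l}" and ?Z = "X \<inter> W"
  have Z: "quad (X \<inter> W) = quad (?Y - {m})"
    by (rule arg_cong[of _ _ quad]) (use assms m_notin l_notin in auto)
  have pl: "p \<noteq> l" "p \<noteq> m" using p_in l_notin m_notin by auto
  have Y: "quad ?Y \<longleftrightarrow> (if m \<in> X then quad ?Z = (p \<in> X) else quad ?Z)"
  proof (cases "m \<in> X")
    case True
    then have "?Y = insert m (?Y - {m})" using m_neq_l by auto
    then have "quad ?Y = (quad ?Z = odd_nb (?Y - {m}) m)"
      using quad_insert[of "?Y - {m}" m] fin Z by auto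
    moreover have "odd_nb (?Y - {m}) m \<longleftrightarrow> p \<in> X"
      using odd_nb_m[of "?Y - {m}"] assms pl by auto
    ultimately show ?thesis using True by simp
  next
    case False
    then show ?thesis using Z by simp
  qed
  have "quad X \<longleftrightarrow> (if l \<in> X then quad ?Y = (m \<in> X) else quad ?Y)"
  proof (cases "l \<in> X")
    case True
    then have "X = insert l ?Y" by auto
    then have "quad X = (quad ?Y = odd_nb ?Y l)"
      using quad_insert[of ?Y l] fin by auto
    moreover have "odd_nb ?Y l \<longleftrightarrow> m \<in> X"
      using odd_nb_l[of ?Y] assms m_neq_l by auto
    ultimately show ?thesis using True by simp
  qed simp
  with Y show ?thesis unfolding excited_def by argo
qed

text \<open>Toggling \<open>l\<close> and \<open>m\<close> permutes the three nonzero vectors of the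
  plane transitively: first insert \<open>m\<close> if it is missing, then use \<open>m\<close> to
  remove \<open>l\<close>.\<close>

lemma excited_reaches_insert_m:
  assumes "X \<subseteq> W'" "excited X"
  shows "reaches W' X (insert m (X \<inter> W))"
proof -
  have *: "reaches W' Y (insert m (Y \<inter> W))" if Y: "Y \<subseteq> W'" "m \<in> Y" for Y
  proof (cases "l \<in> Y")
    case True
    then have "sym_diff Y {l} = insert m (Y \<inter> W)"
      using Y l_notin m_neq_l by auto
    then show ?thesis using reaches_toggle[of l W' Y] odd_nb_l Y by auto
  next
    case False
    then have "Y = insert m (Y \<inter> W)" using Y by auto
    then show ?thesis by auto
  qed
  show ?thesis
  proof (cases "m \<in> X")
    case True
    then show ?thesis using * assms by simp
  next
    case False
    then have "odd_nb X m" using assms odd_nb_m by (auto simp: excited_def)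
    then have "reaches W' X (sym_diff X {m})" by (intro reaches_toggle) auto
    moreover have "reaches W' (sym_diff X {m}) (insert m (sym_diff X {m} \<inter> W))"
      using * False assms by auto
    moreover have "sym_diff X {m} \<inter> W = X \<inter> W" using m_notin by auto
    ultimately show ?thesis by auto
  qed
qed

text \<open>By \<open>quad_pendant\<close> both sets are excited or neither is. Excited ones share a
  normal form; an unexcited one is determined by its part in \<open>W\<close>.\<close>

lemma reaches_fibre:
  assumes "X \<subseteq> W'" "Y \<subseteq> W'" "X \<inter> W = Y \<inter> W" "quad X = quad Y"
  shows "reaches W' X Y"
proof -
  have p: "p \<in> X \<longleftrightarrow> p \<in> Y" using assms p_in by auto
  then have e: "excited X = excited Y"
    using quad_pendant[of X] quad_pendant[of Y] assms by auto
  show ?thesis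
  proof (cases "excited X")
    case True
    then show ?thesis
      using excited_reaches_insert_m[of X] excited_reaches_insert_m[of Y] e assms
      by (metis reaches_sym rtranclp_trans)
  next
    case False
    then have "X = Y" using e p assms unfolding excited_def by auto
    then show ?thesis by simp
  qed
qed

text \<open>The same move works in the larger set unless \<open>m\<close> flips the condition at
  \<open>p\<close>; but then \<open>X\<close> is excited and can first be rid of \<open>m\<close>
  without changing its part in \<open>W\<close>.\<close>

lemma lift_dual_move:
  assumes "X \<subseteq> W'" "dual_move W (X \<inter> W) Z"
  shows "\<exists>Y. reaches W' X Y \<and> Y \<inter> W = Z"
  using assms(2)
proof cases
  case (1 s)
  have lift: ?thesis if "reaches W' X Y" "Y \<inter> W = X \<inter> W" "odd_nb Y s" for Y
  proof (intro exI conjI)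
    show "reaches W' X (sym_diff Y {s})"
      using that reaches_toggle[of s W' Y] 1 by (auto intro: rtranclp_trans)
    show "sym_diff Y {s} \<inter> W = Z" using that 1 by auto
  qed
  show ?thesis
  proof (cases "s = p \<and> m \<in> X")
    case False
    then show ?thesis using lift[of X] odd_nb_W[of X s] assms 1 by auto
  next
    case True
    \<comment> \<open>Inserting \<open>l\<close> exactly when \<open>p\<close> is absent keeps the
      set excited without \<open>m\<close>.\<close>
    let ?Y = "(if p \<in> X then X \<inter> W else insert l (X \<inter> W))"
    have Y: "?Y \<subseteq> W'" "?Y \<inter> W = X \<inter> W" "m \<notin> ?Y"
      using l_notin m_notin m_neq_l by auto
    have "excited ?Y" using p_in l_notin unfolding excited_def by auto
    moreover have "excited X" using True by (simp add: excited_def)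
    moreover have "p \<in> ?Y \<longleftrightarrow> p \<in> X" using p_in l_notin by auto
    ultimately have "quad X = quad ?Y"
      using quad_pendant[of X] quad_pendant[of ?Y] assms Y by auto
    then have "reaches W' X ?Y" using assms Y by (intro reaches_fibre) auto
    then show ?thesis using lift[of ?Y] odd_nb_W[of ?Y s] Y 1 by auto
  qed
qed

lemma lift_reaches:
  assumes "reaches W Z Z'" "X \<subseteq> W'" "X \<inter> W = Z"
  shows "\<exists>Y. reaches W' X Y \<and> Y \<inter> W = Z'"
  using assms
proof (induction rule: rtranclp_induct)
  case base
  then show ?case by auto
next
  case (step Y Z)
  then obtain X' where X': "reaches W' X X'" "X' \<inter> W = Y" by auto
  moreover have "X' \<subseteq> W'" using X' reaches_subset step by blast
  ultimately show ?case using lift_dual_move[of X' Z] step by (metis rtranclp_trans)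
qed

text \<open>The presence of \<open>m\<close> flips the condition at \<open>p\<close>, which permits
  a toggle that the game on \<open>W\<close> forbids and that changes \<open>quad\<close> of the
  part in \<open>W\<close>.\<close>

lemma excited_toggle_p:
  assumes "X \<subseteq> W'" "excited X" "\<not> odd_nb (X \<inter> W) p"
  shows "\<exists>Y. reaches W' X Y \<and> Y \<inter> W = sym_diff (X \<inter> W) {p}"
proof (intro exI conjI)
  let ?Y = "insert m (X \<inter> W)"
  have Y: "?Y \<subseteq> W'" "?Y \<inter> W = X \<inter> W" using m_notin by auto
  then have "odd_nb ?Y p" using odd_nb_W[of ?Y p] p_in assms by simp
  then have "reaches W' ?Y (sym_diff ?Y {p})" using p_in by (intro reaches_toggle) auto
  then show "reaches W' X (sym_diff ?Y {p})"
    using excited_reaches_insert_m assms by (meson rtranclp_trans)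
  show "sym_diff ?Y {p} \<inter> W = sym_diff (X \<inter> W) {p}" using m_notin p_in by auto
qed

text \<open>The case \<open>quad (X \<inter> W) = False\<close> is reduced to the other one by an excited toggle of \<open>p\<close>, which
  changes \<open>quad (X \<inter> W)\<close>; \<^const>\<open>toggleable\<close> provides a set in the orbit of \<open>X \<inter> W\<close> at which this toggle
  is available.\<close>

lemma reaches_singleton_p:
  assumes trans: "transitive W"
    and ex: "(\<forall>Z \<subseteq> W. Z \<noteq> {} \<longrightarrow> quad Z) \<or> toggleable W p"
    and X: "X \<subseteq> W'" "X \<noteq> {}"
  shows "\<exists>Y. reaches W' X Y \<and> Y \<inter> W = {p}"
proof -
  have odd: ?thesis if Y: "reaches W' X Y" "quad (Y \<inter> W)" for Y
  proof -
    have sub: "Y \<subseteq> W'" using Y reaches_subset X by blast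
    have "Y \<inter> W \<noteq> {}" using Y by auto
    then have "reaches W (Y \<inter> W) {p}"
      using trans Y p_in quad_singleton[of p] unfolding transitive_def by auto
    then show ?thesis using lift_reaches[of _ _ Y] sub Y by (metis rtranclp_trans)
  qed
  consider "quad (X \<inter> W)" | "X \<inter> W = {}" | "\<not> quad (X \<inter> W)" "X \<inter> W \<noteq> {}" by auto
  then show ?thesis
  proof cases
    case 1
    then show ?thesis using odd by blast
  next
    case 2
    \<comment> \<open>Here \<open>X\<close> is a nonempty subset of \<open>{l, m}\<close>, and
      toggling \<open>p\<close> turns the empty part in \<open>W\<close> into
      \<open>{p}\<close>.\<close>
    then have "excited X" using X p_in unfolding excited_def by auto
    then show ?thesis using excited_toggle_p[of X] 2 X by auto
  next
    case 3
    \<comment> \<open>Membership of \<open>p\<close> is chosen opposite to \<open>quad X\<close>, so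
      that \<open>quad_pendant\<close> forces every lift of \<open>Z\<close> in the orbit of
      \<open>X\<close> to be excited.\<close>
    obtain Z where Z: "Z \<subseteq> W" "Z \<noteq> {}" "\<not> quad Z" "\<not> odd_nb Z p" "p \<in> Z \<longleftrightarrow> \<not> quad X"
      using ex 3 unfolding toggleable_def by (metis Int_lower2)
    then have "reaches W (X \<inter> W) Z" using trans 3 unfolding transitive_def by auto
    then obtain Y where Y: "reaches W' X Y" "Y \<inter> W = Z"
      using lift_reaches[of _ _ X] X by auto
    have "Y \<subseteq> W'" using Y reaches_subset X by blast
    moreover have "finite X" using X finite_W by (auto intro: finite_subset)
    then have "quad Y = quad X" using quad_reaches Y by blast
    moreover have "p \<in> Y \<longleftrightarrow> p \<in> Z" using Y p_in by auto
    ultimately have "excited Y" using quad_pendant[of Y] Z Y by auto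
    then obtain Y' where Y': "reaches W' Y Y'" "Y' \<inter> W = sym_diff Z {p}"
      using excited_toggle_p[of Y] \<open>Y \<subseteq> W'\<close> Y Z by auto
    have "finite Z" using Z finite_W by (auto intro: finite_subset)
    then have "quad (Y' \<inter> W)" using Y' Z by (simp add: quad_toggle)
    then show ?thesis using odd[of Y'] Y Y' by (meson rtranclp_trans)
  qed
qed

text \<open>Both sets are moved to the common part \<open>{p}\<close> in \<open>W\<close>, after
  which \<open>reaches_fibre\<close> joins them.\<close>

lemma transitive_extend:
  assumes "transitive W"
    and "(\<forall>Z \<subseteq> W. Z \<noteq> {} \<longrightarrow> quad Z) \<or> toggleable W p"
  shows "transitive W'"
  unfolding transitive_def
proof (intro allI impI, elim conjE)
  fix X Y assume XY: "X \<subseteq> W'" "Y \<subseteq> W'" "X \<noteq> {}" "Y \<noteq> {}" "quad X = quad Y"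
  obtain X' where X': "reaches W' X X'" "X' \<inter> W = {p}"
    using reaches_singleton_p[OF assms XY(1,3)] by auto
  obtain Y' where Y': "reaches W' Y Y'" "Y' \<inter> W = {p}"
    using reaches_singleton_p[OF assms XY(2,4)] by auto
  have "finite X" "finite Y" using XY finite_W by (auto intro: finite_subset)
  then have "quad X' = quad Y'" using X' Y' XY quad_reaches by metis
  then have "reaches W' X' Y'"
    using X' Y' XY reaches_subset by (intro reaches_fibre) auto
  then show "reaches W' X Y" using X' Y' reaches_sym by (meson rtranclp_trans)
qed

text \<open>Elimination: the equation at \<open>l\<close> determines \<open>m\<close>, which
  corrects the right-hand side at \<open>p\<close>; after solving on \<open>W\<close>, the equation
  at \<open>m\<close> determines \<open>l\<close>.\<close>

lemma solvable_extend:
  assumes "solvable W"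
  shows "solvable W'"
  unfolding solvable_def
proof (intro allI impI)
  fix F assume "F \<subseteq> W'"
  obtain Z where Z: "Z \<subseteq> W" "\<forall>s \<in> W. odd_nb Z s \<longleftrightarrow> s \<in> {s \<in> W. (s \<in> F) \<noteq> (s = p \<and> l \<in> F)}"
    using assms unfolding solvable_def by (metis (no_types, lifting) mem_Collect_eq subsetI)
  define X where "X = Z \<union> {x. x = m \<and> l \<in> F} \<union> {x. x = l \<and> (m \<in> F) \<noteq> (p \<in> Z)}"
  have X: "X \<subseteq> W'" "X \<inter> W = Z" "m \<in> X \<longleftrightarrow> l \<in> F" "l \<in> X \<longleftrightarrow> (m \<in> F) \<noteq> (p \<in> Z)"
      "p \<in> X \<longleftrightarrow> p \<in> Z"
    using Z m_notin l_notin p_in m_neq_l unfolding X_def by auto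
  show "\<exists>X \<subseteq> W'. \<forall>s \<in> W'. odd_nb X s \<longleftrightarrow> s \<in> F"
  proof (intro exI conjI ballI)
    fix s assume "s \<in> W'"
    then consider "s = l" | "s = m" | "s \<in> W" by auto
    then show "odd_nb X s \<longleftrightarrow> s \<in> F"
    proof cases
      case 1
      then show ?thesis using odd_nb_l[OF X(1)] X by simp
    next
      case 2
      then show ?thesis using odd_nb_m[OF X(1)] X by auto
    next
      case 3
      then show ?thesis using odd_nb_W[OF X(1)] X Z by auto
    qed
  qed (rule X)
qed

text \<open>The vector dual to \<open>p\<close> has two lifts to \<open>W'\<close>, dual to \<open>p\<close> and to \<open>l\<close>; they take different
  values of \<^const>\<open>quad\<close>.\<close>

lemma dual_vectors:
  assumes "solvable W"
  shows "\<exists>X s. X \<subseteq> W' \<and> s \<in> W' \<and> quad X = c \<and> (\<forall>t \<in> W'. odd_nb X t \<longleftrightarrow> t = s)"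
proof -
  obtain Z where Z: "Z \<subseteq> W" "\<forall>s \<in> W. odd_nb Z s \<longleftrightarrow> s = p"
    using assms p_in unfolding solvable_def by (metis empty_subsetI insert_subset singleton_iff)
  \<comment> \<open>Including \<open>m\<close> flips \<open>quad\<close> and shifts the dual vertex
    from \<open>p\<close> to \<open>l\<close>, so \<open>m\<close> is included exactly when the
    value would otherwise differ from \<open>c\<close>.\<close>
  let ?e = "(quad Z \<noteq> (p \<in> Z)) \<noteq> c"
  define X where "X = Z \<union> {x. x = m \<and> ?e} \<union> {x. x = l \<and> p \<in> Z}"
  have X: "X \<subseteq> W'" "X \<inter> W = Z" "m \<in> X \<longleftrightarrow> ?e" "l \<in> X \<longleftrightarrow> p \<in> Z" "p \<in> X \<longleftrightarrow> p \<in> Z"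
    using Z m_notin l_notin p_in m_neq_l unfolding X_def by auto
  have "excited X \<longleftrightarrow> ?e" using X unfolding excited_def by auto
  then have "quad X = c" using quad_pendant[OF X(1)] X by auto
  moreover have "odd_nb X t \<longleftrightarrow> t = (if ?e then l else p)" if t: "t \<in> W'" for t
  proof -
    consider "t = l" | "t = m" | "t \<in> W" using t by auto
    then show ?thesis
    proof cases
      case 1
      then show ?thesis using odd_nb_l[OF X(1)] X p_in l_notin by auto
    next
      case 2
      then show ?thesis using odd_nb_m[OF X(1)] X m_neq_l p_in m_notin by auto
    next
      case 3
      then show ?thesis using odd_nb_W[OF X(1)] X Z l_notin by auto
    qed
  qed
  moreover have "(if ?e then l else p) \<in> W'" using p_in by auto
  ultimately show ?thesis using X(1) by blast
qed

end

section \<open>Trees\<close>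

context pair_graph
begin

text \<open>Connectedness of the induced subgraph, phrased with repetition-free vertex lists so that
  a path can be closed up to a cycle.\<close>

definition linked :: "'a set \<Rightarrow> bool" where
  "linked W \<longleftrightarrow> (\<forall>x \<in> W. \<forall>y \<in> W. \<exists>w. w \<noteq> [] \<and> distinct w \<and> set w \<subseteq> W \<and>
     hd w = x \<and> last w = y \<and> set (vwalk_arcs w) \<subseteq> parcs G)"

lemma linked_singleton: "linked {v}"
  unfolding linked_def by (intro ballI exI[of _ "[v]"]) auto

lemma linked_insert:
  assumes W: "linked W" and x: "x \<in> W" and u: "u \<in> nb x" "u \<notin> W"
  shows "linked (insert u W)"
  unfolding linked_def
proof (intro ballI)
  fix y z assume yz: "y \<in> insert u W" "z \<in> insert u W"
  let ?P = "\<lambda>W y z w. w \<noteq> [] \<and> distinct w \<and> set w \<subseteq> W \<and>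
     hd w = y \<and> last w = z \<and> set (vwalk_arcs w) \<subseteq> parcs G"
  have path: "\<exists>w. ?P W y z w" if "y \<in> W" "z \<in> W" for y z
    using W that unfolding linked_def by blast
  consider "y = u" "z = u" | "y = u" "z \<in> W" | "y \<in> W" "z = u" | "y \<in> W" "z \<in> W"
    using yz by auto
  then show "\<exists>w. ?P (insert u W) y z w"
  proof cases
    case 1
    then show ?thesis by (intro exI[of _ "[u]"]) auto
  next
    case 2
    then obtain w where "?P W x z w" using path x by blast
    moreover have "(u, x) \<in> parcs G" using u nb_sym[of u x] by (simp add: in_nb_iff)
    ultimately show ?thesis using 2 u by (intro exI[of _ "u # w"]) auto
  next
    case 3
    then obtain w where "?P W y x w" using path x by blast
    then show ?thesis using 3 u
      by (intro exI[of _ "w @ [u]"]) (auto simp: set_vwalk_arcs_snoc in_nb_iff)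
  next
    case 4
    then show ?thesis using path by blast
  qed
qed

end

lemma pcas_vwalk_arcs: "w \<noteq> [] \<Longrightarrow> pcas (hd w) (vwalk_arcs w) (last w)"
  by (induction w rule: vwalk_arcs.induct) auto

lemma pawalk_verts_vwalk_arcs: "w \<noteq> [] \<Longrightarrow> pawalk_verts (hd w) (vwalk_arcs w) = w"
  by (induction w rule: vwalk_arcs.induct) auto

locale tree_graph = pair_graph G for G :: "'a pair_pre_digraph" +
  assumes tree: "undirected_tree G"
begin

text \<open>Otherwise a path in \<open>W\<close> from \<open>x\<close> to \<open>y\<close> closes
  through \<open>u\<close> to a cycle. Since \<open>x\<close> and \<open>y\<close> differ, it has at
  least three arcs and so is forbidden in an undirected forest.\<close>

lemma unique_nb:
  assumes W: "linked W" and u: "u \<notin> W"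
    and x: "x \<in> W" "x \<in> nb u" and y: "y \<in> W" "y \<in> nb u"
  shows "x = y"
proof (rule ccontr)
  assume "x \<noteq> y"
  obtain w where w: "w \<noteq> []" "distinct w" "set w \<subseteq> W" "hd w = x" "last w = y"
      "set (vwalk_arcs w) \<subseteq> parcs G"
    using W x y unfolding linked_def by blast
  let ?c = "u # w @ [u]"
  have "2 \<le> length w"
    using w \<open>x \<noteq> y\<close> by (cases w; cases "tl w") auto
  then have len: "3 \<le> length (vwalk_arcs ?c)"
    using vwalk_length_simp[of ?c] unfolding vwalk_length_def by simp
  have arcs: "set (vwalk_arcs ?c) \<subseteq> parcs G"
    using w x y nb_sym[of y u] by (auto simp: set_vwalk_arcs_snoc in_nb_iff)
  have "awalk u (vwalk_arcs ?c) u"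
    using pcas_vwalk_arcs[of ?c] arcs x nb_subset_verts nb_sym[of x u]
    unfolding awalk_def by auto
  moreover have "distinct (tl (pawalk_verts u (vwalk_arcs ?c)))"
    using pawalk_verts_vwalk_arcs[of ?c] w u by auto
  ultimately have "cycle (vwalk_arcs ?c)"
    unfolding cycle_def using len by (intro exI[of _ u]) auto
  then show False
    using tree len unfolding undirected_tree_def undirected_forest_def by blast
qed

lemma no_triangle:
  assumes "y \<in> nb x" "z \<in> nb x" "z \<in> nb y"
  shows False
proof -
  have "linked {y, x}"
    using linked_insert[OF linked_singleton[of x], of x y] assms nb_irrefl by auto
  moreover have "z \<notin> {y, x}" using assms nb_irrefl by auto
  ultimately have "x = y"
    using unique_nb[of "{y, x}" z x y] assms nb_sym[of z x] nb_sym[of z y] by auto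
  then show False using assms nb_irrefl by auto
qed

lemma verts_nonempty: "pverts G \<noteq> {}"
  using tree unfolding undirected_tree_def connected_def strongly_connected_def by auto

text \<open>A set without outgoing edges is closed under reachability, against
  connectedness.\<close>

lemma frontier:
  assumes W: "W \<subseteq> pverts G" "W \<noteq> {}" "W \<noteq> pverts G"
  shows "\<exists>x \<in> W. \<exists>u. u \<in> nb x \<and> u \<notin> W"
proof (rule ccontr)
  assume closed: "\<not> ?thesis"
  obtain x y where xy: "x \<in> W" "y \<in> pverts G" "y \<notin> W" using W by blast
  have "strongly_connected (with_proj G)"
    using tree unfolding undirected_tree_def
    using symmetric_connected_imp_strongly_connected sym_arcs by blast
  then have "x \<rightarrow>\<^sup>*\<^bsub>with_proj G\<^esub> y"
    using xy W unfolding strongly_connected_def by auto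
  then have "y \<in> W"
    using xy(1)
  proof (induction rule: reachable_induct)
    case (step y z)
    then show ?case using closed by (auto simp: in_nb_iff)
  qed
  then show False using xy by simp
qed

end

section \<open>Perfect matchings\<close>

locale matched_tree = tree_graph G for G :: "'a pair_pre_digraph" +
  fixes M :: "'a set set"
  assumes matching: "perfect_matching G M"
begin

lemma mate_nb: "{v, w} \<in> M \<Longrightarrow> w \<in> nb v"
proof -
  assume "{v, w} \<in> M"
  then have "{v, w} \<in> undirected_edges G"
    using matching by (auto simp: perfect_matching_def)
  then show "w \<in> nb v"
    using nb_sym[of v w] by (auto simp: undirected_edges_def in_nb_iff doubleton_eq_iff)
qed

lemma mate_exists: "v \<in> pverts G \<Longrightarrow> \<exists>w. {v, w} \<in> M"
proof -
  assume "v \<in> pverts G"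
  then obtain e where e: "e \<in> M" "v \<in> e"
    using matching unfolding perfect_matching_def by blast
  then obtain a b where "e = {a, b}"
    using matching unfolding perfect_matching_def undirected_edges_def by blast
  then show ?thesis using e by (auto simp: insert_commute)
qed

lemma mate_unique: "{v, w} \<in> M \<Longrightarrow> {v, w'} \<in> M \<Longrightarrow> w = w'"
proof -
  assume *: "{v, w} \<in> M" "{v, w'} \<in> M"
  have "v \<in> pverts G"
    using mate_nb[OF *(1)] nb_sym[of w v] nb_subset_verts by auto
  then have "{v, w} = {v, w'}"
    using matching * unfolding perfect_matching_def by blast
  then show "w = w'" by (auto simp: doubleton_eq_iff)
qed

text \<open>The invariant of the construction. Closure under mates means that a matched edge lies
  inside \<open>W\<close> or misses it, so a new vertex always brings its mate along.\<close>

definition good :: "'a set \<Rightarrow> bool" where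
  "good W \<longleftrightarrow> W \<subseteq> pverts G \<and> linked W \<and> (\<forall>v \<in> W. \<forall>w. {v, w} \<in> M \<longrightarrow> w \<in> W) \<and>
     transitive W \<and> solvable W"

section \<open>Attaching matched edges\<close>

lemma subset_pair_cases:
  assumes "X \<subseteq> {a, v}" "X \<noteq> {}"
  obtains "X = {a}" | "X = {v}" | "X = {a, v}"
proof -
  have "X \<in> Pow {a, v}" using assms by simp
  then have "X = {a} \<or> X = {v} \<or> X = {a, v}"
    using assms(2) by (auto simp: Pow_insert)
  then show ?thesis using that by blast
qed

text \<open>Base case: both singletons reach \<open>{a, v}\<close>, so the nonempty sets form one
  orbit, and the adjacency matrix merely exchanges the two vertices.\<close>

lemma good_edge:
  assumes "{v, a} \<in> M"
  shows "good {a, v}"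
proof -
  have a: "a \<in> nb v" "v \<in> nb a" "a \<noteq> v"
    using mate_nb[OF assms] nb_sym[of a v] nb_irrefl[of a] by auto
  have odd: "odd_nb {v} a" "odd_nb {a} v" "\<not> odd_nb {v} v" "\<not> odd_nb {a} a"
      "odd_nb {a, v} v" "odd_nb {a, v} a"
    using a nb_irrefl by (auto simp: odd_nb_insert)
  have to: "reaches {a, v} X {a, v}" if "X \<subseteq> {a, v}" "X \<noteq> {}" for X
    using that
  proof (cases rule: subset_pair_cases)
    case 1
    moreover have "sym_diff {a} {v} = {a, v}" using a by auto
    ultimately show ?thesis using reaches_toggle[of v "{a, v}" "{a}"] odd by simp
  next
    case 2
    moreover have "sym_diff {v} {a} = {a, v}" using a by auto
    ultimately show ?thesis using reaches_toggle[of a "{a, v}" "{v}"] odd by simp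
  qed simp
  have "transitive {a, v}"
    unfolding transitive_def using to reaches_sym by (meson rtranclp_trans)
  moreover have "solvable {a, v}"
    unfolding solvable_def
  proof (intro allI impI)
    fix F assume F: "F \<subseteq> {a, v}"
    show "\<exists>X \<subseteq> {a, v}. \<forall>s \<in> {a, v}. odd_nb X s \<longleftrightarrow> s \<in> F"
    proof (cases "F = {}")
      case True
      then show ?thesis by (intro exI[of _ "{}"]) auto
    next
      case False
      with F show ?thesis
      proof (cases rule: subset_pair_cases)
        case 1
        then show ?thesis using a odd by (intro exI[of _ "{v}"]) auto
      next
        case 2
        then show ?thesis using a odd by (intro exI[of _ "{a}"]) auto
      next
        case 3
        then show ?thesis using a odd by (intro exI[of _ "{a, v}"]) auto
      qed
    qed
  qed
  moreover have "linked {a, v}"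
    using linked_insert[OF linked_singleton[of v], of v a] a by auto
  moreover have "{a, v} \<subseteq> pverts G" using a nb_subset_verts by auto
  moreover have "w = v" if "{a, w} \<in> M" for w
    using mate_unique[of a w v] that assms by (simp add: insert_commute)
  moreover have "w = a" if "{v, w} \<in> M" for w
    using mate_unique[of v w a] that assms by simp
  ultimately show ?thesis unfolding good_def by blast
qed

text \<open>Closure under mates keeps \<open>l\<close> outside \<open>W\<close>. Acyclicity leaves
  \<open>m\<close> only the neighbor \<open>p\<close> in \<open>W\<close>, and \<open>l\<close> only
  the neighbor \<open>m\<close> in \<open>insert m W\<close>.\<close>

lemma pendant_if_good:
  assumes W: "good W" and p: "p \<in> W" and m: "m \<in> nb p" "m \<notin> W" and l: "{m, l} \<in> M"
  shows "pendant G W p m l"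
proof unfold_locales
  have link: "linked W" using W by (simp add: good_def)
  have lm: "l \<in> nb m" using mate_nb l by simp
  show "W \<subseteq> pverts G" using W by (simp add: good_def)
  show "p \<in> W" "m \<notin> W" "l \<in> nb m" using p m lm by auto
  show l_notin: "l \<notin> W"
    using W l m unfolding good_def by (metis insert_commute)
  show "nb m \<inter> W = {p}"
    using unique_nb[OF link m(2)] p m nb_sym[of p m] by blast
  have "linked (insert m W)" using linked_insert link p m by blast
  moreover have "l \<notin> insert m W" using l_notin lm nb_irrefl by auto
  moreover have "m \<in> nb l" using lm nb_sym[of l m] by simp
  ultimately show "nb l \<inter> W = {}"
    using unique_nb[of "insert m W" l m] m by blast
qed

lemma good_extend:
  assumes W: "good W" and p: "p \<in> W" and m: "m \<in> nb p" "m \<notin> W" and l: "{m, l} \<in> M"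
    and ex: "(\<forall>Z \<subseteq> W. Z \<noteq> {} \<longrightarrow> quad Z) \<or> toggleable W p"
  shows "good (insert l (insert m W))"
proof -
  interpret pendant G W p m l using pendant_if_good assms by blast
  have "linked (insert m W)" using linked_insert W p m unfolding good_def by blast
  then have "linked W'"
    using linked_insert[of "insert m W" m l] l_nb_m m_neq_l l_notin by auto
  moreover have "W' \<subseteq> pverts G"
    using W_verts m l_nb_m nb_subset_verts by blast
  moreover have "w = l" if "{m, w} \<in> M" for w using mate_unique that l by blast
  moreover have "w = m" if "{l, w} \<in> M" for w
    using mate_unique[of l w m] that l by (simp add: insert_commute)
  moreover have "w \<in> W" if "v \<in> W" "{v, w} \<in> M" for v w
    using W that unfolding good_def by blast
  moreover have "transitive W'" "solvable W'"
    using transitive_extend solvable_extend W ex unfolding good_def by auto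
  ultimately show ?thesis unfolding good_def by blast
qed

section \<open>Toggleable vertices\<close>

text \<open>The witnesses are the nonadjacent pairs \<open>{p, w}\<close> and
  \<open>{u, u'}\<close>. Nonadjacency makes \<open>quad\<close> false, and each pair contains an
  even number of neighbors of \<open>p\<close>.\<close>

lemma toggleableI:
  assumes W: "p \<in> W" "w \<in> W" "u \<in> W" "u' \<in> W"
    and w: "w \<noteq> p" "w \<notin> nb p"
    and u: "u \<noteq> u'" "u \<noteq> p" "u' \<noteq> p" "u' \<notin> nb u" "u \<in> nb p \<longleftrightarrow> u' \<in> nb p"
  shows "toggleable W p"
  unfolding toggleable_def
proof
  have nonadj: "\<not> quad {x, y}" if "x \<noteq> y" "y \<notin> nb x" for x y
    using that quad_insert[of "{y}" x] quad_insert[of "{}" y] odd_nb_insert[of y "{}" x] by auto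
  have odd: "odd_nb {x, y} p \<longleftrightarrow> (x \<in> nb p) \<noteq> (y \<in> nb p)" if "x \<noteq> y" for x y
    using that by (auto simp: odd_nb_insert)
  fix e
  show "\<exists>Z \<subseteq> W. Z \<noteq> {} \<and> \<not> quad Z \<and> \<not> odd_nb Z p \<and> (p \<in> Z \<longleftrightarrow> e)"
  proof (cases e)
    case True
    then show ?thesis
      using nonadj[of p w] odd[of p w] W w nb_irrefl by (intro exI[of _ "{p, w}"]) auto
  next
    case False
    then show ?thesis
      using nonadj[of u u'] odd[of u u'] W u by (intro exI[of _ "{u, u'}"]) auto
  qed
qed

text \<open>One of the two neighbors, \<open>b\<close>, is not the mate of \<open>p\<close>; its
  mate \<open>b'\<close> lies at distance two from \<open>p\<close> and serves as \<open>w\<close>.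
  The two neighbors are nonadjacent because a tree has no triangle.\<close>

lemma toggleable_two_nbs:
  assumes W: "good W" "p \<in> W" and u: "u \<in> W" "u \<in> nb p" "u' \<in> W" "u' \<in> nb p" "u \<noteq> u'"
  shows "toggleable W p"
proof -
  obtain b where b: "b \<in> W" "b \<in> nb p" "{p, b} \<notin> M"
    using u mate_unique by metis
  then obtain b' where b': "{b, b'} \<in> M"
    using mate_exists W unfolding good_def by blast
  show ?thesis
  proof (rule toggleableI)
    show "b' \<in> W" using W b b' unfolding good_def by blast
    show "b' \<noteq> p" using b b' by (auto simp: insert_commute)
    show "b' \<notin> nb p" using no_triangle[of b p b'] mate_nb[OF b'] b by auto
    show "u' \<notin> nb u" using no_triangle[of u p u'] u by auto
    show "u \<noteq> p" "u' \<noteq> p" using u nb_irrefl by auto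
  qed (use W u in auto)
qed

text \<open>If \<open>p\<close> has at most one neighbor in \<open>W\<close>, at least three
  vertices of \<open>W\<close> are neither \<open>p\<close> nor adjacent to it. They do not form a
  triangle, which yields \<open>u\<close> and \<open>u'\<close>; any of them serves as
  \<open>w\<close>.\<close>

lemma toggleable_large:
  assumes W: "good W" "p \<in> W" and card: "6 \<le> card W"
  shows "toggleable W p"
proof (cases "\<exists>u \<in> W \<inter> nb p. \<exists>u' \<in> W \<inter> nb p. u \<noteq> u'")
  case True
  then show ?thesis using toggleable_two_nbs W by blast
next
  case False
  have fin: "finite W"
    using W pair_finite_verts unfolding good_def by (auto intro: finite_subset)
  have "card (W \<inter> nb p) \<le> 1"
    using False fin by (simp add: card_le_Suc0_iff_eq)
  then have "card (insert p (W \<inter> nb p)) \<le> 2"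
    using fin by (auto simp: card_insert_if)
  then have "3 \<le> card (W - insert p (W \<inter> nb p))"
    using diff_card_le_card_Diff[of "insert p (W \<inter> nb p)" W] card fin by auto
  then obtain R where R: "R \<subseteq> W - insert p (W \<inter> nb p)" "card R = 3"
    by (meson obtain_subset_with_card_n)
  then obtain x y z where xyz: "R = {x, y, z}" "x \<noteq> y" "y \<noteq> z" "x \<noteq> z"
    by (auto simp: card_3_iff)
  then have in_W: "x \<in> W" "y \<in> W" "z \<in> W" "x \<noteq> p" "y \<noteq> p" "z \<noteq> p"
      "x \<notin> nb p" "y \<notin> nb p" "z \<notin> nb p"
    using R by auto
  have "y \<notin> nb x \<or> z \<notin> nb x \<or> z \<notin> nb y" using no_triangle by blast
  then obtain u u' where "u \<in> {x, y, z}" "u' \<in> {x, y, z}" "u \<noteq> u'" "u' \<notin> nb u"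
    using xyz by auto
  then show ?thesis
    using in_W W by (intro toggleableI[of p W x u u']) auto
qed

section \<open>Growing from \<open>E\<^sub>6\<close> to the whole tree\<close>

text \<open>Each value of \<open>quad\<close> is attained by a vector dual to a single vertex, which
  supplies a target configuration with one on vertex.\<close>

definition spread :: "'a set \<Rightarrow> bool" where
  "spread W \<longleftrightarrow> (\<forall>c. \<exists>X s. X \<subseteq> W \<and> s \<in> W \<and> quad X = c \<and> (\<forall>t \<in> W. odd_nb X t \<longleftrightarrow> t = s))"

lemma spread_extend:
  assumes "good W" "p \<in> W" "m \<in> nb p" "m \<notin> W" "{m, l} \<in> M"
  shows "spread (insert l (insert m W))"
proof -
  interpret pendant G W p m l using pendant_if_good assms by blast
  show ?thesis using dual_vectors assms unfolding spread_def good_def by blast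
qed

lemma card_extend:
  assumes "good W" "p \<in> W" "m \<in> nb p" "m \<notin> W" "{m, l} \<in> M"
  shows "card (insert l (insert m W)) = card W + 2"
proof -
  interpret pendant G W p m l using pendant_if_good assms by blast
  show ?thesis using finite_W m_notin l_notin m_neq_l by auto
qed

text \<open>As long as vertices are missing, an edge leaves \<open>W\<close>, and its outer end is
  attached together with its mate. Six vertices suffice for every attaching point to be
  toggleable.\<close>

lemma good_verts:
  assumes "good W" "spread W" "6 \<le> card W"
  shows "good (pverts G) \<and> spread (pverts G)"
  using assms
proof (induction "card (pverts G) - card W" arbitrary: W rule: less_induct)
  case less
  show ?case
  proof (cases "W = pverts G")
    case True
    then show ?thesis using less.prems by simp
  next
    case False
    have sub: "W \<subseteq> pverts G" using less.prems by (simp add: good_def)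
    obtain p m where pm: "p \<in> W" "m \<in> nb p" "m \<notin> W"
      using frontier[OF sub _ False] less.prems by fastforce
    obtain l where l: "{m, l} \<in> M"
      using mate_exists pm nb_subset_verts by blast
    have "card W < card (pverts G)"
      using sub False pair_finite_verts by (simp add: psubset_card_mono psubsetI)
    then show ?thesis
      using less.hyps[of "insert l (insert m W)"] less.prems pm l
        good_extend[OF _ pm l] toggleable_large spread_extend[OF _ pm l] card_extend[OF _ pm l]
      by auto
  qed
qed

text \<open>The mate \<open>a\<close> of \<open>v\<close>, two further neighbors \<open>b\<close>,
  \<open>c\<close> and their mates form with \<open>v\<close> the diagram \<open>E\<^sub>6\<close>,
  with arms of lengths 1, 2 and 2.\<close>

lemma good_verts_if_branching:
  assumes v: "v \<in> pverts G" "x \<in> nb v" "y \<in> nb v" "z \<in> nb v" "x \<noteq> y" "y \<noteq> z" "x \<noteq> z"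
  shows "good (pverts G) \<and> spread (pverts G)"
proof -
  obtain a where a: "{v, a} \<in> M" using mate_exists v by blast
  obtain b c where bc: "b \<in> nb v" "c \<in> nb v" "b \<noteq> a" "c \<noteq> a" "b \<noteq> c"
    using v by metis
  have va: "a \<in> nb v" using mate_nb a by blast
  have neq: "v \<noteq> a" "b \<noteq> v" "c \<noteq> v" using va bc nb_irrefl by auto
  obtain b' where b': "{b, b'} \<in> M" using mate_exists bc nb_subset_verts by blast
  obtain c' where c': "{c, c'} \<in> M" using mate_exists bc nb_subset_verts by blast
  let ?W1 = "insert b' (insert b {a, v})"
  let ?W2 = "insert c' (insert c ?W1)"
  have W0: "good {a, v}" using good_edge a by simp
  \<comment> \<open>On a single edge all nonempty sets have value 1, so the first attachment does
    not need a toggleable vertex.\<close>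
  have "quad Z" if "Z \<subseteq> {a, v}" "Z \<noteq> {}" for Z
    using that by (cases rule: subset_pair_cases) (use quad_singleton quad_edge va in auto)
  then have W1: "good ?W1"
    using good_extend[OF W0, of v b b'] bc b' neq by auto
  have card1: "card ?W1 = 4"
    using card_extend[OF W0, of v b b'] bc b' neq by auto
  have "c \<noteq> b'"
    using no_triangle[of b v c] mate_nb[OF b'] bc by auto
  then have c: "c \<notin> ?W1" using bc neq by auto
  \<comment> \<open>The second attachment is again at \<open>v\<close>, which now has the two
    neighbors \<open>a\<close> and \<open>b\<close>.\<close>
  have "toggleable ?W1 v"
    using toggleable_two_nbs[OF W1, of v a b] va bc by auto
  then have "good ?W2" using good_extend[OF W1, of v c c'] bc c c' by auto
  moreover have "spread ?W2" using spread_extend[OF W1, of v c c'] bc c c' by auto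
  moreover have "card ?W2 = 6" using card_extend[OF W1, of v c c'] bc c c' card1 by auto
  ultimately show ?thesis using good_verts by simp
qed

section \<open>Translation back to the lit-only game\<close>

text \<open>Toggling \<open>s\<close> in \<open>X\<close> changes \<open>odd_nb X\<close> exactly at
  the neighbors of \<open>s\<close>, and it is allowed exactly when \<open>s\<close> is on.\<close>

lemma lit_moves_if_reaches:
  assumes "reaches (pverts G) X Y"
  shows "(lit_only_move G)\<^sup>*\<^sup>* {t \<in> pverts G. odd_nb X t} {t \<in> pverts G. odd_nb Y t}"
  using assms
proof (induction rule: rtranclp_induct)
  case (step Y Z)
  from step.hyps(2) have "lit_only_move G {t \<in> pverts G. odd_nb Y t} {t \<in> pverts G. odd_nb Z t}"
  proof cases
    case (1 s)
    have "{t \<in> pverts G. odd_nb Z t} = sym_diff {t \<in> pverts G. odd_nb Y t} (nb s)"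
      using nb_subset_verts[of s] nb_sym[of s] by (auto simp: 1 odd_nb_toggle)
    then show ?thesis using lit_only_move.intros[of s _ G] 1 by simp
  qed
  then show ?case using step.IH by simp
qed simp

text \<open>Solvability writes \<open>F\<close> as the configuration of some \<open>X\<close>;
  \<open>spread\<close> gives a target \<open>Y\<close> with the same \<open>quad\<close>, and
  transitivity joins the two.\<close>

lemma lit_if_good:
  assumes "good (pverts G)" "spread (pverts G)"
  shows "lit 1 G"
  unfolding lit_def
proof (intro allI impI)
  fix F assume F: "F \<subseteq> pverts G"
  show "\<exists>Y. (lit_only_move G)\<^sup>*\<^sup>* F Y \<and> int (card Y) \<le> 1"
  proof (cases "F = {}")
    case True
    then show ?thesis by (intro exI[of _ F]) auto
  next
    case False
    have "solvable (pverts G)" using assms by (simp add: good_def)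
    from this[unfolded solvable_def, THEN spec, THEN mp, OF F]
    obtain X where X: "X \<subseteq> pverts G" "\<forall>s \<in> pverts G. odd_nb X s \<longleftrightarrow> s \<in> F"
      by (elim exE conjE) (rule that)
    obtain Y s where Y: "Y \<subseteq> pverts G" "s \<in> pverts G" "quad Y = quad X"
        "\<forall>t \<in> pverts G. odd_nb Y t \<longleftrightarrow> t = s"
      using assms(2)[unfolded spread_def, THEN spec, of "quad X"]
      by (elim exE conjE) (rule that)
    have "X \<noteq> {}" using X F False by auto
    moreover have "Y \<noteq> {}" using Y by auto
    ultimately have "reaches (pverts G) X Y"
      using assms X Y unfolding good_def transitive_def by blast
    then have "(lit_only_move G)\<^sup>*\<^sup>* {t \<in> pverts G. odd_nb X t} {t \<in> pverts G. odd_nb Y t}"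
      by (rule lit_moves_if_reaches)
    moreover have "{t \<in> pverts G. odd_nb X t} = F" using X F by auto
    moreover have "{t \<in> pverts G. odd_nb Y t} = {s}" using Y by auto
    ultimately show ?thesis by (intro exI[of _ "{s}"]) auto
  qed
qed

end

section \<open>Paths\<close>

context pair_graph
begin

text \<open>A configuration on a path is encoded by the parities \<open>y k\<close> of the number of on vertices
  among the first \<open>k\<close> ones, up to complementing \<open>y\<close>. A move at the \<open>i\<close>-th vertex swaps
  \<open>y i\<close> and \<open>y (i + 1)\<close>, so sorting \<open>y\<close> leaves at most one on vertex.\<close>

definition path_conf :: "'a list \<Rightarrow> (nat \<Rightarrow> bool) \<Rightarrow> 'a set" where
  "path_conf vs y = {vs ! i |i. i < length vs \<and> y i \<noteq> y (Suc i)}"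

text \<open>Linkedness is included so that \<open>unique_nb\<close> applies to the vertex set of the
  path.\<close>

definition induced_path :: "'a list \<Rightarrow> bool" where
  "induced_path vs \<longleftrightarrow> vs \<noteq> [] \<and> distinct vs \<and> set vs \<subseteq> pverts G \<and> linked (set vs) \<and>
     (\<forall>i < length vs. \<forall>j < length vs. vs ! j \<in> nb (vs ! i) \<longleftrightarrow> j = Suc i \<or> i = Suc j)"

lemma nth_in_path_conf:
  assumes "distinct vs" "i < length vs"
  shows "vs ! i \<in> path_conf vs y \<longleftrightarrow> y i \<noteq> y (Suc i)"
  using assms unfolding path_conf_def by (auto simp: nth_eq_iff_index_eq)

lemma path_conf_swap:
  assumes vs: "induced_path vs" "set vs = pverts G"
    and i: "i < length vs" "\<not> y i" "y (Suc i)"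
  shows "lit_only_move G (path_conf vs y) (path_conf vs (y(i := True, Suc i := False)))"
proof -
  let ?y = "y(i := True, Suc i := False)"
  have dist: "distinct vs" using vs by (simp add: induced_path_def)
  have "path_conf vs ?y = sym_diff (path_conf vs y) (nb (vs ! i))"
  proof (rule set_eqI)
    fix v
    show "v \<in> path_conf vs ?y \<longleftrightarrow> v \<in> sym_diff (path_conf vs y) (nb (vs ! i))"
    proof (cases "v \<in> set vs")
      case True
      then obtain j where j: "j < length vs" "v = vs ! j" by (auto simp: in_set_conv_nth)
      have "v \<in> nb (vs ! i) \<longleftrightarrow> j = Suc i \<or> i = Suc j"
        using vs i j by (simp add: induced_path_def)
      \<comment> \<open>The swapped values differ, so the swap alters the comparisons at
        \<open>i - 1\<close> and \<open>i + 1\<close> but not the one at \<open>i\<close>.\<close>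
      moreover have "?y j \<noteq> ?y (Suc j) \<longleftrightarrow> (y j \<noteq> y (Suc j)) \<noteq> (j = Suc i \<or> i = Suc j)"
        using i by auto
      ultimately show ?thesis
        using nth_in_path_conf[OF dist j(1)] j by auto
    next
      case False
      then show ?thesis
        using vs nb_subset_verts[of "vs ! i"] by (auto simp: path_conf_def)
    qed
  qed
  moreover have "vs ! i \<in> path_conf vs y"
    using nth_in_path_conf[OF dist i(1)] i by simp
  ultimately show ?thesis using lit_only_move.intros[of "vs ! i" _ G] by simp
qed

text \<open>Each swap moves a true entry one place to the left, which lowers the sum of the
  positions of true entries. The bound \<open>k \<le> length vs\<close> is inclusive because
  \<open>y\<close> has one more relevant entry than the path has vertices.\<close>

lemma path_conf_sort:
  assumes vs: "induced_path vs" "set vs = pverts G"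
  shows "\<exists>Y. (lit_only_move G)\<^sup>*\<^sup>* (path_conf vs y) Y \<and> card Y \<le> 1"
proof (induction "\<Sum>k \<in> {k. k \<le> length vs \<and> y k}. k" arbitrary: y rule: less_induct)
  case less
  show ?case
  proof (cases "\<exists>i < length vs. \<not> y i \<and> y (Suc i)")
    case True
    then obtain i where i: "i < length vs" "\<not> y i" "y (Suc i)" by auto
    let ?y = "y(i := True, Suc i := False)"
    let ?K = "{k. k \<le> length vs \<and> y k}" and ?K' = "{k. k \<le> length vs \<and> ?y k}"
    have fin: "finite ?K" by auto
    have "?K' = insert i (?K - {Suc i})" using i by auto
    then have "\<Sum>?K' = i + \<Sum>(?K - {Suc i})" using fin i by simp
    moreover have "\<Sum>?K = Suc i + \<Sum>(?K - {Suc i})"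
      using fin i by (intro sum.remove) auto
    ultimately have "\<Sum>?K' < \<Sum>?K" by linarith
    then obtain Y where "(lit_only_move G)\<^sup>*\<^sup>* (path_conf vs ?y) Y" "card Y \<le> 1"
      using less.hyps[of ?y] by blast
    then show ?thesis
      using path_conf_swap[OF vs i] by (meson converse_rtranclp_into_rtranclp)
  next
    case False
    \<comment> \<open>Without an ascent all true entries precede all false ones, so \<open>y\<close>
      changes value at most once.\<close>
    have mono: "y i" if "y j" "i \<le> j" "j \<le> length vs" for i j
      using that(2,1,3)
    proof (induction rule: inc_induct)
      case (step n)
      then have "n < length vs" "y (Suc n)" by auto
      then show ?case using False by blast
    qed
    have eq: "i = j" if "y i \<noteq> y (Suc i)" "y j \<noteq> y (Suc j)" "i < length vs" "j < length vs" for i j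
      using that mono[of "Suc i" i] mono[of "Suc j" j] mono[of j "Suc i"] mono[of i "Suc j"]
      by (cases i j rule: linorder_cases) auto
    have "card (path_conf vs y) \<le> Suc 0"
    proof (rule iffD2[OF card_le_Suc0_iff_eq])
      show "finite (path_conf vs y)" by (simp add: path_conf_def)
      show "\<forall>a \<in> path_conf vs y. \<forall>b \<in> path_conf vs y. a = b"
        using eq unfolding path_conf_def by blast
    qed
    then show ?thesis by (intro exI[of _ "path_conf vs y"]) auto
  qed
qed

lemma lit_if_path:
  assumes vs: "induced_path vs" "set vs = pverts G"
  shows "lit 1 G"
  unfolding lit_def
proof (intro allI impI)
  fix F assume F: "F \<subseteq> pverts G"
  have dist: "distinct vs" using vs by (simp add: induced_path_def)
  \<comment> \<open>Prefix parities, so that consecutive values differ exactly at on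
    vertices.\<close>
  define y where "y k \<longleftrightarrow> odd (card {i. i < k \<and> vs ! i \<in> F})" for k
  have "y (Suc k) \<longleftrightarrow> y k \<noteq> (vs ! k \<in> F)" for k
  proof -
    have "{i. i < Suc k \<and> vs ! i \<in> F} =
        (if vs ! k \<in> F then insert k {i. i < k \<and> vs ! i \<in> F} else {i. i < k \<and> vs ! i \<in> F})"
      by (auto simp: less_Suc_eq)
    then show ?thesis by (simp add: y_def)
  qed
  then have "path_conf vs y = F"
    using F unfolding path_conf_def vs(2)[symmetric] by (auto simp: in_set_conv_nth subset_iff)
  then show "\<exists>Y. (lit_only_move G)\<^sup>*\<^sup>* F Y \<and> int (card Y) \<le> 1"
    using path_conf_sort[OF vs, of y] by auto
qed

lemma induced_path_rev:
  assumes "induced_path vs"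
  shows "induced_path (rev vs)"
proof -
  have "rev vs ! j \<in> nb (rev vs ! i) \<longleftrightarrow> j = Suc i \<or> i = Suc j"
    if "i < length vs" "j < length vs" for i j
  proof -
    have "rev vs ! j \<in> nb (rev vs ! i) \<longleftrightarrow>
        length vs - Suc j = Suc (length vs - Suc i) \<or> length vs - Suc i = Suc (length vs - Suc j)"
      using assms that by (simp add: induced_path_def rev_nth)
    also have "\<dots> \<longleftrightarrow> j = Suc i \<or> i = Suc j" using that by auto
    finally show ?thesis .
  qed
  then show ?thesis using assms by (auto simp: induced_path_def)
qed

end

section \<open>Spanning paths in trees of maximum degree at most two\<close>

context tree_graph
begin

text \<open>No chord arises: by \<open>unique_nb\<close> the head is the only neighbor of
  \<open>u\<close> on the path.\<close>

lemma induced_path_Cons: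
  assumes vs: "induced_path vs" and u: "u \<in> nb (hd vs)" "u \<notin> set vs"
  shows "induced_path (u # vs)"
proof -
  have ne: "vs \<noteq> []" and link: "linked (set vs)" and dist: "distinct vs"
    using vs by (auto simp: induced_path_def)
  have hd: "hd vs = vs ! 0" using ne by (simp add: hd_conv_nth)
  have "vs ! j \<in> nb u \<longleftrightarrow> j = 0" if "j < length vs" for j
  proof
    assume "vs ! j \<in> nb u"
    then have "vs ! j = hd vs"
      using unique_nb[OF link u(2), of "vs ! j" "hd vs"] that u nb_sym[of u "hd vs"] ne by auto
    then show "j = 0" using that dist hd ne by (simp add: nth_eq_iff_index_eq)
  next
    assume "j = 0"
    then show "vs ! j \<in> nb u" using u hd nb_sym[of u "hd vs"] by simp
  qed
  moreover have "u \<in> nb (vs ! j) \<longleftrightarrow> vs ! j \<in> nb u" for j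
    by (rule nb_sym)
  moreover have "vs ! j \<in> nb (vs ! i) \<longleftrightarrow> j = Suc i \<or> i = Suc j"
    if "i < length vs" "j < length vs" for i j
    using vs that by (simp add: induced_path_def)
  ultimately have adj: "(u # vs) ! j \<in> nb ((u # vs) ! i) \<longleftrightarrow> j = Suc i \<or> i = Suc j"
    if "i < length (u # vs)" "j < length (u # vs)" for i j
    using that nb_irrefl[of u] by (cases i; cases j) simp_all
  have "linked (set (u # vs))"
    using linked_insert[OF link _ u] ne by simp
  moreover have "u \<in> pverts G" using u nb_subset_verts by blast
  moreover have "set vs \<subseteq> pverts G" using vs by (simp add: induced_path_def)
  ultimately show ?thesis
    using dist u(2) adj unfolding induced_path_def by (intro conjI allI impI) simp_all
qed

text \<open>An interior vertex already has two neighbors on the path, so by the degree bound an edge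
  leaving the path starts at an end; reversal reduces the last vertex to the first.\<close>

lemma induced_path_extend:
  assumes deg: "\<And>v x y z. x \<in> nb v \<Longrightarrow> y \<in> nb v \<Longrightarrow> z \<in> nb v \<Longrightarrow> x = y \<or> y = z \<or> x = z"
    and vs: "induced_path vs" "set vs \<noteq> pverts G"
  shows "\<exists>ws. induced_path ws \<and> length ws = Suc (length vs)"
proof -
  have ne: "vs \<noteq> []" and sub: "set vs \<subseteq> pverts G" and dist: "distinct vs"
    using vs by (auto simp: induced_path_def)
  obtain x u where xu: "x \<in> set vs" "u \<in> nb x" "u \<notin> set vs"
    using frontier[OF sub] ne vs by auto
  obtain k where k: "k < length vs" "x = vs ! k" using xu by (auto simp: in_set_conv_nth)
  have "k = 0 \<or> Suc k = length vs"
  proof (rule ccontr)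
    assume "\<not> ?thesis"
    then obtain i where i: "k = Suc i" "Suc k < length vs" using k by (cases k) auto
    then have "vs ! i \<in> nb x" "vs ! Suc k \<in> nb x"
      using vs k by (auto simp: induced_path_def)
    moreover have "vs ! i \<noteq> vs ! Suc k"
      using dist i by (simp add: nth_eq_iff_index_eq)
    moreover have "vs ! i \<in> set vs" "vs ! Suc k \<in> set vs" using i by auto
    ultimately show False using deg[of "vs ! i" x "vs ! Suc k" u] xu by auto
  qed
  then consider "x = hd vs" | "x = hd (rev vs)"
    using k ne by (metis hd_conv_nth hd_rev last_conv_nth diff_Suc_1)
  then show ?thesis
  proof cases
    case 1
    then show ?thesis using induced_path_Cons[OF vs(1)] xu by (intro exI[of _ "u # vs"]) auto
  next
    case 2
    then show ?thesis
      using induced_path_Cons[OF induced_path_rev[OF vs(1)]] xu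
      by (intro exI[of _ "u # rev vs"]) auto
  qed
qed

lemma spanning_path:
  assumes deg: "\<And>v x y z. x \<in> nb v \<Longrightarrow> y \<in> nb v \<Longrightarrow> z \<in> nb v \<Longrightarrow> x = y \<or> y = z \<or> x = z"
  shows "\<exists>vs. induced_path vs \<and> set vs = pverts G"
proof -
  obtain v where "v \<in> pverts G" using verts_nonempty by auto
  then have path: "induced_path [v]"
    using linked_singleton nb_irrefl by (auto simp: induced_path_def)
  have bound: "length vs < Suc (card (pverts G))" if "induced_path vs" for vs
    using that pair_finite_verts distinct_card[of vs] card_mono[of "pverts G" "set vs"]
    by (auto simp: induced_path_def)
  \<comment> \<open>A longest induced path cannot be extended and therefore spans the tree.\<close>
  obtain vs where vs: "induced_path vs" "\<And>ws. induced_path ws \<Longrightarrow> length ws \<le> length vs"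
    using ex_has_greatest_nat[of induced_path "[v]" length] path bound by blast
  then show ?thesis using induced_path_extend[OF deg] by fastforce
qed

end

theorem theorem1p1:
  fixes G :: "'a pair_pre_digraph"
  assumes "pair_graph G"
    and "undirected_tree G"
    and "\<exists>M. perfect_matching G M"
  shows "lit 1 G"
proof -
  obtain M where M: "perfect_matching G M" using assms(3) by blast
  interpret pair_graph G by (rule assms(1))
  interpret matched_tree G M using assms(2) M by unfold_locales
  show ?thesis
  proof (cases "\<exists>v x y z. x \<in> nb v \<and> y \<in> nb v \<and> z \<in> nb v \<and> x \<noteq> y \<and> y \<noteq> z \<and> x \<noteq> z")
    case True
    then obtain v x y z where v: "x \<in> nb v" "y \<in> nb v" "z \<in> nb v" "x \<noteq> y" "y \<noteq> z" "x \<noteq> z"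
      by blast
    moreover have "v \<in> pverts G" using v nb_sym[of x v] nb_subset_verts by blast
    ultimately show ?thesis using good_verts_if_branching lit_if_good by blast
  next
    case False
    then obtain vs where "induced_path vs" "set vs = pverts G"
      using spanning_path by metis
    then show ?thesis by (rule lit_if_path)
  qed
qed

end
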